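(* Fix an integer $k\ge 0$ and a real number $\epsilon>0$, and let $p=p(n)\in[0,1]$ satisfy $p\le n^{-1/(k+1)-\epsilon}$. If $X$ is a random simplicial complex distributed as $X(n,p)$, then with high probability $X$ is $(k+1)$-collapsible; that is, $P(X \text{ is } (k+1)\text{-collapsible})\to 1$ as $n\to\infty$.
   Context: A simplicial complex is a clique complex (flag complex) if it is the maximal simplicial complex supported on its edge set, i.e. every complete subgraph of its 1-skeleton is filled in with a simplex. $X(n,p)$ is the probability space of clique complexes on $n$ vertices in which each edge appears independently with probability $p$; equivalently, one samples a graph from the Erdős–Rényi model $G(n,p)$ and takes its clique complex. A property holds with high probability if its probability tends to $1$ as $n\to\infty$. Let $\Delta$ be a simplicial complex with (nonempty) faces $\sigma\subsetneq\tau$ such that $\tau$ is a maximal face of $\Delta$ and $\sigma$ is contained in no other maximal face of $\Delta$. Then $\sigma$ is called a free face of $\tau$, and the simplicial collapse of the interval $[\sigma,\tau]$ is the removal from $\Delta$ of all faces $\eta$ with $\sigma\subseteq\eta\subseteq\tau$. A complex is $m$-collapsible if all its faces of dimension at least $m$ can be collapsed, i.e. there is a finite (possibly empty) sequence of simplicial collapses reducing it to a complex of dimension at most $m-1$. *)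

theory Defs
  imports "HOL-Probability.Probability"
begin

section \<open>Simplicial complexes and collapses\<close>

text \<open>A complex is the set of its nonempty faces; the empty set is never a face.\<close>

definition simplicial_complex :: "'a set set \<Rightarrow> bool" where
  "simplicial_complex \<Delta> \<longleftrightarrow>
     (\<forall>\<sigma>\<in>\<Delta>. finite \<sigma> \<and> \<sigma> \<noteq> {}) \<and>
     (\<forall>\<sigma>\<in>\<Delta>. \<forall>\<tau>. \<tau> \<subseteq> \<sigma> \<and> \<tau> \<noteq> {} \<longrightarrow> \<tau> \<in> \<Delta>)"

definition face_dim :: "'a set \<Rightarrow> int" where
  "face_dim \<sigma> = int (card \<sigma>) - 1"

definition maximal_face :: "'a set set \<Rightarrow> 'a set \<Rightarrow> bool" where
  "maximal_face \<Delta> \<tau> \<longleftrightarrow> \<tau> \<in> \<Delta> \<and> (\<forall>\<eta>\<in>\<Delta>. \<tau> \<subseteq> \<eta> \<longrightarrow> \<eta> = \<tau>)"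

definition free_face :: "'a set set \<Rightarrow> 'a set \<Rightarrow> 'a set \<Rightarrow> bool" where
  "free_face \<Delta> \<sigma> \<tau> \<longleftrightarrow>
     \<sigma> \<in> \<Delta> \<and> \<sigma> \<noteq> {} \<and> \<sigma> \<subset> \<tau> \<and> maximal_face \<Delta> \<tau> \<and>
     (\<forall>\<tau>'. maximal_face \<Delta> \<tau>' \<and> \<sigma> \<subseteq> \<tau>' \<longrightarrow> \<tau>' = \<tau>)"

definition collapse_step :: "'a set set \<Rightarrow> 'a set set \<Rightarrow> bool" where
  "collapse_step \<Delta> \<Delta>' \<longleftrightarrow>
     (\<exists>\<sigma> \<tau>. free_face \<Delta> \<sigma> \<tau> \<and> \<Delta>' = \<Delta> - {\<eta>. \<sigma> \<subseteq> \<eta> \<and> \<eta> \<subseteq> \<tau>})"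

definition collapsible :: "nat \<Rightarrow> 'a set set \<Rightarrow> bool" where
  "collapsible m \<Delta> \<longleftrightarrow>
     (\<exists>\<Delta>'. collapse_step\<^sup>*\<^sup>* \<Delta> \<Delta>' \<and> (\<forall>\<sigma>\<in>\<Delta>'. face_dim \<sigma> \<le> int m - 1))"

section \<open>Clique complexes\<close>

text \<open>A graph is given by its vertex set and a set of two-element sets of vertices.\<close>

definition clique_complex :: "'a set \<Rightarrow> 'a set set \<Rightarrow> 'a set set" where
  "clique_complex V E =
     {\<sigma>. \<sigma> \<subseteq> V \<and> finite \<sigma> \<and> \<sigma> \<noteq> {} \<and> (\<forall>u\<in>\<sigma>. \<forall>v\<in>\<sigma>. u \<noteq> v \<longrightarrow> {u, v} \<in> E)}"

lemma simplicial_complex_clique_complex: "simplicial_complex (clique_complex V E)"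
  unfolding simplicial_complex_def clique_complex_def
  by (auto intro: finite_subset)

lemma edges_clique_complex:
  assumes "E \<subseteq> {e. e \<subseteq> V \<and> card e = 2}"
  shows "{e \<in> clique_complex V E. card e = 2} = E"
proof (intro subset_antisym subsetI)
  fix e assume "e \<in> {e \<in> clique_complex V E. card e = 2}"
  then have c: "e \<in> clique_complex V E" "card e = 2" by simp_all
  obtain u v where "e = {u, v}" "u \<noteq> v" using c(2) unfolding card_2_iff by blast
  with c(1) show "e \<in> E" unfolding clique_complex_def by simp
next
  fix e assume e: "e \<in> E"
  then have "e \<subseteq> V" "card e = 2" using assms by auto
  moreover obtain u v where "e = {u, v}" "u \<noteq> v"
    using \<open>card e = 2\<close> unfolding card_2_iff by blast
  ultimately show "e \<in> {e \<in> clique_complex V E. card e = 2}"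
    using e unfolding clique_complex_def by (simp add: insert_commute)
qed

lemma clique_complex_maximal:
  assumes "simplicial_complex \<Delta>" "\<Union>\<Delta> \<subseteq> V" "{e \<in> \<Delta>. card e = 2} \<subseteq> E"
  shows "\<Delta> \<subseteq> clique_complex V E"
proof
  fix \<sigma> assume \<sigma>: "\<sigma> \<in> \<Delta>"
  have "{u, v} \<in> E" if "u \<in> \<sigma>" "v \<in> \<sigma>" "u \<noteq> v" for u v
  proof -
    have "{u, v} \<in> \<Delta>"
      using assms(1)[unfolded simplicial_complex_def, THEN conjunct2, rule_format, OF \<sigma>, of "{u, v}"] that
      by simp
    then show ?thesis using assms(3) that by auto
  qed
  moreover have "\<sigma> \<subseteq> V" using assms(2) \<sigma> by auto
  moreover have "finite \<sigma> \<and> \<sigma> \<noteq> {}"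
    using assms(1) \<sigma> unfolding simplicial_complex_def by simp
  ultimately show "\<sigma> \<in> clique_complex V E"
    unfolding clique_complex_def by simp
qed

section \<open>The random clique complex\<close>

definition potential_edges :: "nat \<Rightarrow> nat set set" where
  "potential_edges n = {e. e \<subseteq> {..<n} \<and> card e = 2}"

text \<open>
  The Erdos-Renyi edge set on the vertices \<open>0, \<dots>, n - 1\<close>: one independent Bernoulli variable
  for each potential edge.
\<close>

definition random_graph :: "nat \<Rightarrow> real \<Rightarrow> nat set set pmf" where
  "random_graph n p =
     map_pmf (\<lambda>b. {e \<in> potential_edges n. b e})
       (Pi_pmf (potential_edges n) False (\<lambda>_. bernoulli_pmf p))"

definition random_clique_complex :: "nat \<Rightarrow> real \<Rightarrow> nat set set pmf" where
  "random_clique_complex n p = map_pmf (clique_complex {..<n}) (random_graph n p)"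

end

theory Submission
  imports Defs
begin

text \<open>
  Consider the strongly connected families of faces of dimension at least \<open>k\<close>. If in each such
  family some vertex has at most \<open>2 * k + 1\<close> neighbours, then the faces of the family at that vertex
  can be collapsed down to dimension \<open>k\<close>, because a flag complex on at most \<open>2 * k + 1\<close> vertices
  (here the link) collapses to dimension \<open>k - 1\<close>; deleting them, one proceeds by induction.
  Otherwise some strongly connected family has minimum degree at least \<open>2 * k + 2\<close>. If it has at
  most \<open>M\<close> vertices, these span at least \<open>k + 1\<close> edges per vertex; if it has more, growing it one
  vertex at a time yields \<open>M\<close> vertices spanning at least \<open>(k + 1) * (M - k - 1)\<close> edges. For a
  constant \<open>M > k + 1 + 1 / \<epsilon>\<close> a union bound excludes both cases with high probability.
\<close>

section \<open>Elementary collapses\<close>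

text \<open>
  Only faces with at least \<open>m\<close> vertices take part, so low-dimensional faces never obstruct a
  collapse. Families need not be downward closed, and for \<open>m = 0\<close> (links) the empty face may be
  the free one.
\<close>

inductive elem_collapsible :: "nat \<Rightarrow> 'a set set \<Rightarrow> bool" for m where
  small: "(\<And>\<eta>. \<eta> \<in> F \<Longrightarrow> finite \<eta> \<and> card \<eta> \<le> m) \<Longrightarrow> elem_collapsible m F"
| remove: "\<lbrakk>\<sigma> \<in> F; insert x \<sigma> \<in> F; x \<notin> \<sigma>; finite \<sigma>; m \<le> card \<sigma>;
    \<And>\<eta>. \<lbrakk>\<eta> \<in> F; \<sigma> \<subset> \<eta>\<rbrakk> \<Longrightarrow> \<eta> = insert x \<sigma>;
    elem_collapsible m (F - {\<sigma>, insert x \<sigma>})\<rbrakk> \<Longrightarrow> elem_collapsible m F"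

text \<open>Each elementary removal is a simplicial collapse: the interval from
  \<open>\<sigma>\<close> to \<open>insert x \<sigma>\<close> has only these two members, and
  \<open>\<sigma>\<close> is not itself maximal. The bound \<open>m \<ge> 1\<close> makes
  \<open>\<sigma>\<close> nonempty, as a free face must be.\<close>

lemma collapsible_if_elem_collapsible:
  assumes "elem_collapsible m \<Delta>" "m \<ge> 1"
  shows "collapsible m \<Delta>"
  using assms
proof (induction rule: elem_collapsible.induct)
  case (small F)
  then have "\<forall>\<sigma>\<in>F. face_dim \<sigma> \<le> int m - 1"
    unfolding face_dim_def by fastforce
  then show ?case unfolding collapsible_def by blast
next
  case (remove \<sigma> F x)
  have sub: "\<sigma> \<subset> insert x \<sigma>" using remove.hyps by auto
  have max: "maximal_face F (insert x \<sigma>)"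
    unfolding maximal_face_def using remove.hyps sub by blast
  have uniq: "\<tau>' = insert x \<sigma>" if "maximal_face F \<tau>'" "\<sigma> \<subseteq> \<tau>'" for \<tau>'
  proof -
    have "\<tau>' \<noteq> \<sigma>" using that(1) remove.hyps(2) sub unfolding maximal_face_def by blast
    then show ?thesis using that remove.hyps(6) unfolding maximal_face_def by blast
  qed
  have "\<sigma> \<noteq> {}" using remove.hyps(5) remove.prems by auto
  then have "free_face F \<sigma> (insert x \<sigma>)"
    unfolding free_face_def using remove.hyps(1) sub max uniq by blast
  moreover have "{\<eta>. \<sigma> \<subseteq> \<eta> \<and> \<eta> \<subseteq> insert x \<sigma>} = {\<sigma>, insert x \<sigma>}" by auto
  ultimately have "collapse_step F (F - {\<sigma>, insert x \<sigma>})"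
    unfolding collapse_step_def by metis
  with remove.IH[OF remove.prems] show ?case
    unfolding collapsible_def by (meson converse_rtranclp_into_rtranclp)
qed

text \<open>Collapse \<open>F\<close> first: by the last hypothesis its free faces stay free beside
  \<open>H\<close>. What is left of \<open>F\<close> has at most \<open>m\<close> vertices per face,
  too few to properly contain a free face of \<open>H\<close> with at least \<open>m\<close>
  vertices.\<close>

lemma elem_collapsible_Un:
  assumes "elem_collapsible m F" "elem_collapsible m H" "F \<inter> H = {}"
    and "\<And>\<sigma> \<eta>. \<lbrakk>\<sigma> \<in> F; \<eta> \<in> H; m \<le> card \<sigma>\<rbrakk> \<Longrightarrow> \<not> \<sigma> \<subset> \<eta>"
  shows "elem_collapsible m (F \<union> H)"
  using assms(1,3,4)
proof (induction rule: elem_collapsible.induct)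
  case (small F)
  from assms(2) small show ?case
  proof (induction rule: elem_collapsible.induct)
    case (small H)
    then show ?case by (intro elem_collapsible.small) auto
  next
    case (remove \<sigma> H x)
    have "insert x \<sigma> \<notin> F" using remove.prems(2) remove.hyps(2) by blast
    moreover have "\<sigma> \<notin> F" using remove.prems(2) remove.hyps(1) by blast
    ultimately have eq: "F \<union> H - {\<sigma>, insert x \<sigma>} = F \<union> (H - {\<sigma>, insert x \<sigma>})" by blast
    have "\<not> \<sigma> \<subset> \<eta>" if "\<eta> \<in> F" for \<eta>
      using remove.prems(1)[OF that] remove.hyps(5) by (meson leD le_trans psubset_card_mono)
    then have "\<eta> = insert x \<sigma>" if "\<eta> \<in> F \<union> H" "\<sigma> \<subset> \<eta>" for \<eta>
      using remove.hyps(6) that by blast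
    moreover have "elem_collapsible m (F \<union> H - {\<sigma>, insert x \<sigma>})"
      unfolding eq using remove.prems by (intro remove.IH) auto
    ultimately show ?case
      by (rule elem_collapsible.remove[OF UnI2 UnI2 remove.hyps(3-5),
            OF remove.hyps(1,2)])
  qed
next
  case (remove \<sigma> F x)
  have "insert x \<sigma> \<notin> H" "\<sigma> \<notin> H" using remove.prems(1) remove.hyps(1,2) by blast+
  then have eq: "F \<union> H - {\<sigma>, insert x \<sigma>} = (F - {\<sigma>, insert x \<sigma>}) \<union> H" by blast
  have "elem_collapsible m (F \<union> H - {\<sigma>, insert x \<sigma>})"
    unfolding eq using remove.prems by (intro remove.IH) auto
  moreover have "\<eta> = insert x \<sigma>" if "\<eta> \<in> F \<union> H" "\<sigma> \<subset> \<eta>" for \<eta>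
    using remove.hyps(6) remove.prems(2)[OF remove.hyps(1) _ remove.hyps(5)] that by blast
  ultimately show ?case
    by (intro elem_collapsible.remove[OF UnI1 UnI1 remove.hyps(3-5),
          OF remove.hyps(1,2)])
qed

text \<open>A removed pair is comparable, so it lies entirely inside or entirely outside
  \<open>A\<close>; dropping the pairs outside leaves a valid collapse of \<open>A\<close>.\<close>

lemma elem_collapsible_restrict:
  assumes "elem_collapsible m F" "A \<subseteq> F"
    and "\<And>\<sigma> \<tau>. \<lbrakk>\<sigma> \<in> F; \<tau> \<in> F; \<sigma> \<subseteq> \<tau>; m \<le> card \<sigma>\<rbrakk> \<Longrightarrow> \<sigma> \<in> A \<longleftrightarrow> \<tau> \<in> A"
  shows "elem_collapsible m A"
  using assms
proof (induction arbitrary: A rule: elem_collapsible.induct)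
  case (small F)
  then show ?case by (intro elem_collapsible.small) auto
next
  case (remove \<sigma> F x)
  have iff: "\<sigma> \<in> A \<longleftrightarrow> insert x \<sigma> \<in> A"
    using remove.hyps by (intro remove.prems(2)) auto
  have "elem_collapsible m (A - {\<sigma>, insert x \<sigma>})"
    using remove.prems by (intro remove.IH) auto
  moreover have "\<eta> = insert x \<sigma>" if "\<eta> \<in> A" "\<sigma> \<subset> \<eta>" for \<eta>
    using remove.hyps(6) remove.prems(1) that by blast
  ultimately have "elem_collapsible m A" if "\<sigma> \<in> A"
    using elem_collapsible.remove[of \<sigma> A x m, OF that _ remove.hyps(3-5)] iff that by blast
  moreover have "A - {\<sigma>, insert x \<sigma>} = A" if "\<sigma> \<notin> A" using iff that by blast
  ultimately show ?case
    using \<open>elem_collapsible m (A - {\<sigma>, insert x \<sigma>})\<close> by metis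
qed

text \<open>Adding \<open>v\<close> is an isomorphism of inclusion orders that raises each size by
  one; it carries collapses of a link over to the star.\<close>

lemma elem_collapsible_insert:
  assumes "elem_collapsible m F" "\<And>\<eta>. \<eta> \<in> F \<Longrightarrow> v \<notin> \<eta>"
  shows "elem_collapsible (Suc m) (insert v ` F)"
  using assms
proof (induction rule: elem_collapsible.induct)
  case (small F)
  then show ?case by (intro elem_collapsible.small) auto
next
  case (remove \<sigma> F x)
  have v: "v \<notin> \<sigma>" "v \<noteq> x" using remove.prems remove.hyps(1,2) by blast+
  have inj: "inj_on (insert v) F"
    using remove.prems by (intro inj_onI) (metis insert_ident)
  have "insert v ` F - {insert v \<sigma>, insert x (insert v \<sigma>)} = insert v ` (F - {\<sigma>, insert x \<sigma>})"
    using inj_on_image_set_diff[OF inj, of F "{\<sigma>, insert x \<sigma>}"] remove.hyps(1,2)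
    by (auto simp: insert_commute)
  then have "elem_collapsible (Suc m) (insert v ` F - {insert v \<sigma>, insert x (insert v \<sigma>)})"
    using remove by auto
  moreover have "\<eta> = insert x (insert v \<sigma>)" if \<eta>: "\<eta> \<in> insert v ` F" "insert v \<sigma> \<subset> \<eta>" for \<eta>
  proof -
    obtain \<rho> where \<rho>: "\<rho> \<in> F" "\<eta> = insert v \<rho>" using \<eta>(1) by blast
    then have "\<sigma> \<subset> \<rho>" using \<eta>(2) v remove.prems[OF \<rho>(1)] by auto
    then show ?thesis using remove.hyps(6)[OF \<rho>(1)] \<rho>(2) by auto
  qed
  moreover have "insert x (insert v \<sigma>) \<in> insert v ` F"
    using remove.hyps(2) by (metis image_eqI insert_commute)
  moreover have "insert v \<sigma> \<in> insert v ` F" "x \<notin> insert v \<sigma>" "finite (insert v \<sigma>)"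
    "Suc m \<le> card (insert v \<sigma>)"
    using remove.hyps v by simp_all
  ultimately show ?case
    using elem_collapsible.remove[of "insert v \<sigma>" "insert v ` F" x "Suc m"] by blast
qed

text \<open>Faces are matched by adding or deleting \<open>w\<close>. A face of maximal size
  contains \<open>w\<close>, since otherwise adding \<open>w\<close> would enlarge it; so for such a
  face \<open>\<tau>\<close>, the only face properly above \<open>\<tau> - {w}\<close> is
  \<open>\<tau>\<close>. Removing this pair preserves the hypotheses.\<close>

lemma elem_collapsible_cone:
  assumes "finite F" "\<And>\<eta>. \<eta> \<in> F \<Longrightarrow> finite \<eta>"
    and "\<And>\<eta>. \<eta> \<in> F \<Longrightarrow> insert w \<eta> \<in> F"
    and "\<And>\<eta>. \<lbrakk>\<eta> \<in> F; w \<in> \<eta>; m < card \<eta>\<rbrakk> \<Longrightarrow> \<eta> - {w} \<in> F"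
  shows "elem_collapsible m F"
  using assms
proof (induction F rule: finite_psubset_induct)
  case (psubset F)
  show ?case
  proof (cases "\<forall>\<eta>\<in>F. card \<eta> \<le> m")
    case True
    then show ?thesis using psubset.prems by (intro elem_collapsible.small) auto
  next
    case False
    then obtain \<eta> where \<eta>: "\<eta> \<in> F" "m < card \<eta>" by auto
    then have "Max (card ` F) \<in> card ` F" "card \<eta> \<le> Max (card ` F)"
      using psubset.hyps by (auto intro!: Max_in)
    with \<eta>(2) obtain \<tau> where \<tau>: "\<tau> \<in> F" "m < card \<tau>" "card \<tau> = Max (card ` F)" by fastforce
    have max: "card \<eta> \<le> card \<tau>" if "\<eta> \<in> F" for \<eta>
      using \<tau>(3) that psubset.hyps by auto
    have w: "w \<in> \<eta>" if "\<eta> \<in> F" "card \<tau> \<le> card \<eta>" for \<eta>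
    proof (rule ccontr)
      assume "w \<notin> \<eta>"
      then have "card (insert w \<eta>) = Suc (card \<eta>)" using psubset.prems that by simp
      with max[OF psubset.prems(2)[OF that(1)]] that(2) show False by simp
    qed
    define \<sigma> where "\<sigma> = \<tau> - {w}"
    have fin: "finite \<tau>" using psubset.prems \<tau> by auto
    have wt: "w \<in> \<tau>" using w[OF \<tau>(1)] by simp
    have ins: "insert w \<sigma> = \<tau>" using wt unfolding \<sigma>_def by auto
    have \<sigma>: "\<sigma> \<in> F" "w \<notin> \<sigma>" "finite \<sigma>" "m \<le> card \<sigma>" "Suc (card \<sigma>) = card \<tau>"
      using psubset.prems(3)[OF \<tau>(1) wt \<tau>(2)] fin \<tau>(2) card_Suc_Diff1[OF fin wt]
      unfolding \<sigma>_def by auto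
    have free: "\<eta> = insert w \<sigma>" if \<eta>: "\<eta> \<in> F" "\<sigma> \<subset> \<eta>" for \<eta>
    proof -
      have f: "finite \<eta>" using psubset.prems \<eta> by auto
      then have "card \<sigma> < card \<eta>" using \<eta>(2) by (rule psubset_card_mono)
      then have "w \<in> \<eta>" using w[OF \<eta>(1)] \<sigma>(5) by simp
      then have "\<tau> \<subseteq> \<eta>" using \<eta>(2) ins by auto
      then show ?thesis using card_seteq[OF f _ max[OF \<eta>(1)]] ins by auto
    qed
    have "elem_collapsible m (F - {\<sigma>, insert w \<sigma>})"
    proof (rule psubset.IH)
      show "F - {\<sigma>, insert w \<sigma>} \<subset> F" using \<sigma>(1) by blast
      show "insert w \<eta> \<in> F - {\<sigma>, insert w \<sigma>}" if "\<eta> \<in> F - {\<sigma>, insert w \<sigma>}" for \<eta>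
        using that psubset.prems(2)[of \<eta>] \<sigma>(2) by auto
      show "\<eta> - {w} \<in> F - {\<sigma>, insert w \<sigma>}"
        if "\<eta> \<in> F - {\<sigma>, insert w \<sigma>}" "w \<in> \<eta>" "m < card \<eta>" for \<eta>
        using that psubset.prems(3)[of \<eta>] ins by auto
    qed (use psubset.prems in auto)
    then show ?thesis
      using elem_collapsible.remove[OF \<sigma>(1) _ \<sigma>(2-4) free] ins \<tau>(1) by blast
  qed
qed

section \<open>Flag complexes on few vertices\<close>

text \<open>Unlike \<open>clique_complex\<close>, this contains the empty clique when
  \<open>m = 0\<close>, so that links and stars match exactly. Since infinite sets have
  \<open>card\<close> 0, that case is meant for finite \<open>S\<close>.\<close>

definition cliques :: "'a set set \<Rightarrow> 'a set \<Rightarrow> nat \<Rightarrow> 'a set set" where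
  "cliques E S m = {\<eta>. \<eta> \<subseteq> S \<and> m \<le> card \<eta> \<and> (\<forall>u\<in>\<eta>. \<forall>v\<in>\<eta>. u \<noteq> v \<longrightarrow> {u, v} \<in> E)}"

lemma finite_cliques: "finite S \<Longrightarrow> finite (cliques E S m)"
  by (rule finite_subset[of _ "Pow S"]) (auto simp: cliques_def)

lemma finite_mem_cliques: "\<lbrakk>finite S; \<eta> \<in> cliques E S m\<rbrakk> \<Longrightarrow> finite \<eta>"
  by (auto simp: cliques_def intro: finite_subset)

text \<open>The link of a vertex in a flag complex is again a flag complex, on the neighbours of the
  vertex; this lets inductions pass to links.\<close>

lemma cliques_link:
  assumes "finite S" "w \<in> S"
  shows "{\<eta> \<in> cliques E S (Suc m). w \<in> \<eta>} = insert w ` cliques E {x \<in> S - {w}. {w, x} \<in> E} m"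
    (is "?L = ?R")
proof (intro equalityI subsetI)
  fix \<eta> assume \<eta>: "\<eta> \<in> ?L"
  then have "finite \<eta>" using finite_mem_cliques assms(1) by blast
  then have "card (\<eta> - {w}) = card \<eta> - 1" using \<eta> by simp
  then have "\<eta> - {w} \<in> cliques E {x \<in> S - {w}. {w, x} \<in> E} m"
    using \<eta> unfolding cliques_def by auto
  moreover have "\<eta> = insert w (\<eta> - {w})" using \<eta> by auto
  ultimately show "\<eta> \<in> ?R" by blast
next
  fix \<eta> assume "\<eta> \<in> ?R"
  then obtain \<rho> where \<rho>: "\<eta> = insert w \<rho>" "\<rho> \<in> cliques E {x \<in> S - {w}. {w, x} \<in> E} m" by blast
  have \<rho>': "\<rho> \<subseteq> S - {w}" "m \<le> card \<rho>" "\<And>x. x \<in> \<rho> \<Longrightarrow> {w, x} \<in> E"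
    "\<And>x y. \<lbrakk>x \<in> \<rho>; y \<in> \<rho>; x \<noteq> y\<rbrakk> \<Longrightarrow> {x, y} \<in> E"
    using \<rho>(2) unfolding cliques_def by auto
  have "finite \<rho>" using \<rho>'(1) assms(1) by (meson finite_Diff finite_subset)
  moreover have "w \<notin> \<rho>" using \<rho>'(1) by blast
  ultimately have "Suc m \<le> card \<eta>" using \<rho>(1) \<rho>'(2) by simp
  moreover have "\<eta> \<subseteq> S" using \<rho>(1) \<rho>'(1) assms(2) by blast
  moreover have "{x, y} \<in> E" if "x \<in> \<eta>" "y \<in> \<eta>" "x \<noteq> y" for x y
    using that \<rho>(1) \<rho>'(3)[of x] \<rho>'(3)[of y] \<rho>'(4)[of x y] by (metis insertE insert_commute)
  ultimately show "\<eta> \<in> ?L" using \<rho>(1) unfolding cliques_def by blast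
qed

text \<open>
  The bound is sharp: the boundary of the cross-polytope has \<open>2 * k + 2\<close> vertices. If no vertex
  is a cone point, every vertex has a non-neighbour, so links have at least two vertices fewer.
\<close>

lemma elem_collapsible_cliques:
  assumes "finite W" "card W \<le> 2 * k + 1"
  shows "elem_collapsible k (cliques E W k)"
  using assms
proof (induction W arbitrary: k rule: finite_psubset_induct)
  case (psubset W)
  consider "W = {}" | w where "w \<in> W" "\<forall>x\<in>W - {w}. {w, x} \<in> E"
    | w u where "w \<in> W" "u \<in> W" "u \<noteq> w" "{w, u} \<notin> E"
    by blast
  then show ?case
  proof cases
    case 1
    then show ?thesis by (intro elem_collapsible.small) (auto simp: cliques_def)
  next
    case (2 w)
    show ?thesis
    proof (rule elem_collapsible_cone[where w = w])
      show "finite (cliques E W k)" using psubset.hyps by (rule finite_cliques)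
      show fin: "finite \<eta>" if "\<eta> \<in> cliques E W k" for \<eta>
        using psubset.hyps that by (rule finite_mem_cliques)
      show "insert w \<eta> \<in> cliques E W k" if "\<eta> \<in> cliques E W k" for \<eta>
      proof -
        have "card \<eta> \<le> card (insert w \<eta>)" using fin[OF that] by (intro card_mono) auto
        then show ?thesis using that 2 unfolding cliques_def
          by (auto simp: insert_commute subset_iff)
      qed
      show "\<eta> - {w} \<in> cliques E W k" if "\<eta> \<in> cliques E W k" "w \<in> \<eta>" "k < card \<eta>" for \<eta>
        using that fin[OF that(1)] unfolding cliques_def by auto
    qed
  next
    case (3 w u)
    \<comment> \<open>Two vertices exceed the bound \<open>2 * k + 1\<close> at
      \<open>k = 0\<close>, so \<open>k\<close> has a predecessor, which is the parameter for the
      link.\<close>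
    have "card {w, u} \<le> card W" using 3 psubset.hyps by (intro card_mono) auto
    then obtain k' where k: "k = Suc k'" using 3 psubset.prems by (cases k) auto
    define W' where "W' = {x \<in> W - {w}. {w, x} \<in> E}"
    have W': "W' \<subseteq> W - {w, u}" using 3 unfolding W'_def by auto
    have "card W' \<le> card (W - {w, u})" using W' psubset.hyps by (intro card_mono) auto
    also have "\<dots> = card W - 2" using 3 by (subst card_Diff_subset) auto
    finally have "card W' \<le> 2 * k' + 1" using psubset.prems k by simp
    moreover have "W' \<subset> W" using W' 3 by blast
    ultimately have "elem_collapsible k' (cliques E W' k')" by (intro psubset.IH)
    then have "elem_collapsible k (insert w ` cliques E W' k')"
      unfolding k by (rule elem_collapsible_insert) (use W' in \<open>auto simp: cliques_def\<close>)
    then have 1: "elem_collapsible k {\<eta> \<in> cliques E W k. w \<in> \<eta>}"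
      using cliques_link[OF psubset.hyps 3(1)] unfolding k W'_def by simp
    have "card (W - {w}) \<le> 2 * k + 1" using psubset.prems 3 by simp
    then have 2: "elem_collapsible k (cliques E (W - {w}) k)"
      using 3 by (intro psubset.IH) auto
    \<comment> \<open>Faces through \<open>w\<close> go first: none of them lies in a face avoiding
      \<open>w\<close>.\<close>
    have "elem_collapsible k ({\<eta> \<in> cliques E W k. w \<in> \<eta>} \<union> cliques E (W - {w}) k)"
      by (rule elem_collapsible_Un[OF 1 2]) (auto simp: cliques_def)
    moreover have "{\<eta> \<in> cliques E W k. w \<in> \<eta>} \<union> cliques E (W - {w}) k = cliques E W k"
      by (auto simp: cliques_def)
    ultimately show ?thesis by simp
  qed
qed

section \<open>Strongly connected families of cliques\<close>

text \<open>
  Two cliques with \<open>m + 1\<close> vertices sharing \<open>m\<close> of them are both comparable to their intersection,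
  so the comparability classes of \<open>cliques E S m\<close> are the strongly connected components.
\<close>

definition comparability_closed :: "'a set set \<Rightarrow> 'a set set \<Rightarrow> bool" where
  "comparability_closed K A \<longleftrightarrow>
     A \<subseteq> K \<and> (\<forall>\<sigma>\<in>A. \<forall>\<tau>\<in>K. \<sigma> \<subseteq> \<tau> \<or> \<tau> \<subseteq> \<sigma> \<longrightarrow> \<tau> \<in> A)"

lemma comparability_closed_subset: "comparability_closed K A \<Longrightarrow> A \<subseteq> K"
  by (simp add: comparability_closed_def)

lemma comparability_closedD:
  "\<lbrakk>comparability_closed K A; \<sigma> \<in> A; \<tau> \<in> K; \<sigma> \<subseteq> \<tau> \<or> \<tau> \<subseteq> \<sigma>\<rbrakk> \<Longrightarrow> \<tau> \<in> A"
  unfolding comparability_closed_def by blast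

text \<open>A single class, expressed by minimality among nonempty closed subfamilies instead of by
  paths. Thus every nonempty proper subfamily has a comparable face outside it.\<close>

definition comparability_connected :: "'a set set \<Rightarrow> 'a set set \<Rightarrow> bool" where
  "comparability_connected K A \<longleftrightarrow> A \<noteq> {} \<and> comparability_closed K A \<and>
     (\<forall>B. B \<noteq> {} \<and> B \<subseteq> A \<and> comparability_closed K B \<longrightarrow> B = A)"

lemma comparability_connectedD:
  "\<lbrakk>comparability_connected K A; comparability_closed K B; B \<noteq> {}; B \<subseteq> A\<rbrakk> \<Longrightarrow> B = A"
  unfolding comparability_connected_def by blast

text \<open>These are the vertices of the link of \<open>v\<close> in \<open>A\<close>, possibly
  fewer than the graph neighbours of \<open>v\<close> in \<open>\<Union>A\<close>.\<close>

definition family_nbrs :: "'a set set \<Rightarrow> 'a \<Rightarrow> 'a set" where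
  "family_nbrs A v = \<Union>{\<eta> \<in> A. v \<in> \<eta>} - {v}"

lemma family_nbrs_subset:
  assumes "A \<subseteq> cliques E S m"
  shows "family_nbrs A v \<subseteq> {x \<in> \<Union>A - {v}. {v, x} \<in> E}"
proof
  fix x assume "x \<in> family_nbrs A v"
  then obtain \<eta> where \<eta>: "\<eta> \<in> A" "v \<in> \<eta>" "x \<in> \<eta>" "x \<noteq> v"
    unfolding family_nbrs_def by blast
  then have "\<eta> \<in> cliques E S m" using assms by blast
  then have "{v, x} \<in> E" using \<eta>(2-4) unfolding cliques_def by auto
  then show "x \<in> {x \<in> \<Union>A - {v}. {v, x} \<in> E}" using \<eta> by blast
qed

text \<open>The link \<open>B\<close> of \<open>v\<close> in \<open>A\<close> may miss some cliques
  on the neighbours of \<open>v\<close>, but it is closed under comparability among those with at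
  least \<open>k\<close> vertices. So a collapse of the full flag complex on at most
  \<open>2 * k + 1\<close> vertices restricts to \<open>B\<close>, and adding \<open>v\<close> gives
  the star.\<close>

lemma elem_collapsible_star:
  assumes "finite S" and cl: "comparability_closed (cliques E S (Suc k)) A"
    and deg: "card (family_nbrs A v) \<le> 2 * k + 1"
  shows "elem_collapsible (Suc k) {\<eta> \<in> A. v \<in> \<eta>}"
proof (cases "v \<in> S")
  case False
  then have "v \<notin> \<eta>" if "\<eta> \<in> A" for \<eta>
    using comparability_closed_subset[OF cl] that by (auto simp: cliques_def)
  then have "{\<eta> \<in> A. v \<in> \<eta>} = {}" by blast
  then show ?thesis by (metis elem_collapsible.small empty_iff)
next
  case True
  let ?N = "family_nbrs A v"
  have AS: "A \<subseteq> cliques E S (Suc k)" using cl by (rule comparability_closed_subset)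
  then have "\<Union>A \<subseteq> S" unfolding cliques_def by blast
  then have N: "?N \<subseteq> {x \<in> S - {v}. {v, x} \<in> E}"
    using family_nbrs_subset[OF AS, of v] by blast
  then have finN: "finite ?N" by (rule finite_subset) (use \<open>finite S\<close> in simp)
  define B where "B = {\<eta> \<in> cliques E ?N k. insert v \<eta> \<in> A}"
  have star: "insert v \<eta> \<in> cliques E S (Suc k)" if "\<eta> \<in> cliques E ?N k" for \<eta>
  proof -
    have "\<eta> \<in> cliques E {x \<in> S - {v}. {v, x} \<in> E} k"
      using that order_trans[OF _ N] by (simp add: cliques_def)
    then show ?thesis using cliques_link[OF \<open>finite S\<close> True, of E k] by blast
  qed
  have "elem_collapsible k B"
  proof (rule elem_collapsible_restrict[OF elem_collapsible_cliques[OF finN deg]])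
    show "\<sigma> \<in> B \<longleftrightarrow> \<tau> \<in> B"
      if "\<sigma> \<in> cliques E ?N k" "\<tau> \<in> cliques E ?N k" "\<sigma> \<subseteq> \<tau>" for \<sigma> \<tau>
    proof -
      have "insert v \<sigma> \<subseteq> insert v \<tau>" using that(3) by auto
      then have "insert v \<sigma> \<in> A \<longleftrightarrow> insert v \<tau> \<in> A"
        using comparability_closedD[OF cl] star[OF that(1)] star[OF that(2)] by metis
      then show ?thesis using that(1,2) by (simp add: B_def)
    qed
  qed (auto simp: B_def)
  then have "elem_collapsible (Suc k) (insert v ` B)"
  proof (rule elem_collapsible_insert)
    show "v \<notin> \<eta>" if "\<eta> \<in> B" for \<eta>
      using that N by (simp add: B_def cliques_def) blast
  qed
  moreover have "insert v ` B = {\<eta> \<in> A. v \<in> \<eta>}"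
  proof (intro equalityI subsetI)
    fix \<eta> assume \<eta>: "\<eta> \<in> {\<eta> \<in> A. v \<in> \<eta>}"
    then have "\<eta> \<in> insert v ` cliques E {x \<in> S - {v}. {v, x} \<in> E} k"
      using AS cliques_link[OF \<open>finite S\<close> True, of E k] by blast
    then obtain \<rho> where \<rho>: "\<eta> = insert v \<rho>" "\<rho> \<in> cliques E {x \<in> S - {v}. {v, x} \<in> E} k"
      by blast
    then have "v \<notin> \<rho>" by (auto simp: cliques_def)
    then have "\<rho> \<subseteq> ?N" using \<eta> \<rho>(1) by (auto simp: family_nbrs_def)
    then have "\<rho> \<in> cliques E ?N k" using \<rho>(2) by (simp add: cliques_def)
    then have "\<rho> \<in> B" using \<rho>(1) \<eta> by (simp add: B_def)
    then show "\<eta> \<in> insert v ` B" using \<rho> by blast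
  qed (auto simp: B_def)
  ultimately show ?thesis by simp
qed

text \<open>Induction on \<open>A\<close>. A nonempty family that is not connected splits into a
  closed part and its complement, with no inclusions between them. A connected one loses the star of
  a low-degree vertex \<open>v\<close>; the rest is closed relative to \<open>S - {v}\<close>, which
  is why \<open>low\<close> ranges over all \<open>S\<close>.\<close>

lemma elem_collapsible_if_low_degree:
  assumes "finite V"
    and low: "\<And>S A. \<lbrakk>S \<subseteq> V; comparability_connected (cliques E S (Suc k)) A\<rbrakk>
      \<Longrightarrow> (\<exists>v\<in>\<Union>A. card (family_nbrs A v) \<le> 2 * k + 1)"
    and "S \<subseteq> V" "comparability_closed (cliques E S (Suc k)) A"
  shows "elem_collapsible (Suc k) A"
proof -
  have "finite A"
    using assms(1,3) comparability_closed_subset[OF assms(4)] finite_cliques finite_subset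
    by metis
  then show ?thesis using assms(3,4)
  proof (induction A arbitrary: S rule: finite_psubset_induct)
    case (psubset A)
    let ?K = "cliques E S (Suc k)"
    have finS: "finite S" using psubset.prems assms(1) finite_subset by blast
    have AK: "A \<subseteq> ?K" using psubset.prems(2) by (rule comparability_closed_subset)
    consider "A = {}" | "comparability_connected ?K A"
      | B where "B \<noteq> {}" "B \<subset> A" "comparability_closed ?K B"
      using psubset.prems unfolding comparability_connected_def by blast
    then show ?case
    proof cases
      case 1
      then show ?thesis by (auto intro: elem_collapsible.small)
    next
      case 2
      then obtain v where v: "v \<in> \<Union>A" "card (family_nbrs A v) \<le> 2 * k + 1"
        using low psubset.prems by blast
      have star: "elem_collapsible (Suc k) {\<eta> \<in> A. v \<in> \<eta>}"
        using elem_collapsible_star[OF finS psubset.prems(2) v(2)] .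
      have rest: "elem_collapsible (Suc k) {\<eta> \<in> A. v \<notin> \<eta>}"
      proof (rule psubset.IH)
        show "{\<eta> \<in> A. v \<notin> \<eta>} \<subset> A" using v(1) by blast
        show "S - {v} \<subseteq> V" using psubset.prems by blast
        show "comparability_closed (cliques E (S - {v}) (Suc k)) {\<eta> \<in> A. v \<notin> \<eta>}"
          unfolding comparability_closed_def
        proof (intro conjI ballI impI)
          have "\<eta> \<in> cliques E (S - {v}) (Suc k)" if "\<eta> \<in> A" "v \<notin> \<eta>" for \<eta>
            using subsetD[OF AK that(1)] that(2) by (auto simp: cliques_def)
          then show "{\<eta> \<in> A. v \<notin> \<eta>} \<subseteq> cliques E (S - {v}) (Suc k)" by blast
          fix \<sigma> \<tau>
          assume "\<sigma> \<in> {\<eta> \<in> A. v \<notin> \<eta>}" "\<tau> \<in> cliques E (S - {v}) (Suc k)"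
            "\<sigma> \<subseteq> \<tau> \<or> \<tau> \<subseteq> \<sigma>"
          moreover from this(2) have "\<tau> \<in> ?K" "v \<notin> \<tau>" by (auto simp: cliques_def)
          ultimately show "\<tau> \<in> {\<eta> \<in> A. v \<notin> \<eta>}"
            using comparability_closedD[OF psubset.prems(2)] by blast
        qed
      qed
      have "elem_collapsible (Suc k) ({\<eta> \<in> A. v \<in> \<eta>} \<union> {\<eta> \<in> A. v \<notin> \<eta>})"
        by (rule elem_collapsible_Un[OF star rest]) auto
      moreover have "{\<eta> \<in> A. v \<in> \<eta>} \<union> {\<eta> \<in> A. v \<notin> \<eta>} = A" by auto
      ultimately show ?thesis by simp
    next
      case (3 B)
      have "comparability_closed ?K (A - B)"
        unfolding comparability_closed_def
      proof (intro conjI ballI impI)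
        fix \<sigma> \<tau> assume st: "\<sigma> \<in> A - B" "\<tau> \<in> ?K" "\<sigma> \<subseteq> \<tau> \<or> \<tau> \<subseteq> \<sigma>"
        then have "\<tau> \<in> A" using comparability_closedD[OF psubset.prems(2), of \<sigma> \<tau>] by blast
        moreover have "\<tau> \<notin> B"
          using comparability_closedD[OF 3(3), of \<tau> \<sigma>] st AK by blast
        ultimately show "\<tau> \<in> A - B" by blast
      qed (use AK in blast)
      then have "elem_collapsible (Suc k) (A - B)"
        using 3 psubset.prems(1) by (intro psubset.IH) auto
      moreover have "elem_collapsible (Suc k) B"
        using 3 psubset.prems(1) by (intro psubset.IH) auto
      ultimately have "elem_collapsible (Suc k) (B \<union> (A - B))"
        using comparability_closedD[OF 3(3)] AK
        by (intro elem_collapsible_Un) (blast | metis DiffE psubset_imp_subset subsetD)+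
      moreover have "B \<union> (A - B) = A" using 3 by blast
      ultimately show ?thesis by simp
    qed
  qed
qed

text \<open>The cliques with more than \<open>k\<close> vertices form a closed family. The smaller
  faces are added afterwards: they already satisfy the dimension bound and cannot contain a larger
  face.\<close>

lemma collapsible_clique_complex_if_low_degree:
  assumes "finite V"
    and low: "\<And>S A. \<lbrakk>S \<subseteq> V; comparability_connected (cliques E S (Suc k)) A\<rbrakk>
      \<Longrightarrow> (\<exists>v\<in>\<Union>A. card (family_nbrs A v) \<le> 2 * k + 1)"
  shows "collapsible (k + 1) (clique_complex V E)"
proof -
  let ?K = "cliques E V (Suc k)" and ?H = "{\<eta> \<in> clique_complex V E. card \<eta> \<le> k}"
  have 1: "elem_collapsible (Suc k) ?K"
    by (rule elem_collapsible_if_low_degree[OF assms order_refl])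
       (auto simp: comparability_closed_def)
  have 2: "elem_collapsible (Suc k) ?H"
    by (rule elem_collapsible.small) (auto simp: clique_complex_def)
  have "elem_collapsible (Suc k) (?K \<union> ?H)"
  proof (rule elem_collapsible_Un[OF 1 2])
    show "\<not> \<sigma> \<subset> \<eta>" if "\<sigma> \<in> ?K" "\<eta> \<in> ?H" for \<sigma> \<eta>
      using that psubset_card_mono[of \<eta> \<sigma>] by (auto simp: cliques_def clique_complex_def)
  qed (auto simp: cliques_def)
  moreover have "?K \<union> ?H = clique_complex V E"
    using finite_subset[OF _ \<open>finite V\<close>] by (auto simp: cliques_def clique_complex_def)
  ultimately show ?thesis by (auto intro: collapsible_if_elem_collapsible)
qed

section \<open>Dense vertex sets\<close>

definition edges_within :: "'a set set \<Rightarrow> 'a set \<Rightarrow> 'a set set" where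
  "edges_within E U = {e \<in> E. e \<subseteq> U \<and> card e = 2}"

lemma finite_edges_within: "finite U \<Longrightarrow> finite (edges_within E U)"
  by (rule finite_subset[of _ "Pow U"]) (auto simp: edges_within_def)

text \<open>Double counting of incidences: each edge has two ends, so degree \<open>2 * d\<close>
  yields \<open>d\<close> edges per vertex.\<close>

lemma card_edges_within_min_degree:
  assumes "finite U" and deg: "\<And>v. v \<in> U \<Longrightarrow> 2 * d \<le> card {x \<in> U - {v}. {v, x} \<in> E}"
  shows "d * card U \<le> card (edges_within E U)"
proof -
  let ?D = "edges_within E U"
  have fin: "finite ?D" using assms(1) by (rule finite_edges_within)
  have "2 * d \<le> card {e \<in> ?D. v \<in> e}" if v: "v \<in> U" for v
  proof -
    have "inj_on (\<lambda>x. {v, x}) {x \<in> U - {v}. {v, x} \<in> E}"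
      by (auto simp: inj_on_def doubleton_eq_iff)
    moreover have "(\<lambda>x. {v, x}) ` {x \<in> U - {v}. {v, x} \<in> E} \<subseteq> {e \<in> ?D. v \<in> e}"
      using v by (auto simp: edges_within_def)
    ultimately have "card {x \<in> U - {v}. {v, x} \<in> E} \<le> card {e \<in> ?D. v \<in> e}"
      by (rule card_inj_on_le) (use fin in simp)
    then show ?thesis using deg[OF v] by linarith
  qed
  then have "(\<Sum>v\<in>U. 2 * d) \<le> (\<Sum>v\<in>U. card {e \<in> ?D. v \<in> e})" by (intro sum_mono)
  also have "\<dots> = 2 * card ?D"
  proof (rule sum_multicount[OF assms(1) fin], intro ballI)
    fix e assume "e \<in> ?D"
    then have "{v \<in> U. v \<in> e} = e" "card e = 2" by (auto simp: edges_within_def)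
    then show "card {v \<in> U. v \<in> e} = 2" by simp
  qed
  finally show ?thesis by (simp add: mult.commute)
qed

text \<open>
  A family that is connected through faces with at least \<open>m\<close> vertices can be built up one vertex
  at a time, each new vertex being joined to at least \<open>m\<close> old ones.
\<close>

lemma dense_subset_of_connected:
  assumes "finite S" and conn: "comparability_connected (cliques E S m) A"
    and "m \<le> s" "s \<le> card (\<Union>A)"
  shows "\<exists>U\<subseteq>\<Union>A. card U = s \<and> (\<exists>\<eta>\<in>A. \<eta> \<subseteq> U) \<and> m * (s - m) \<le> card (edges_within E U)"
  using assms(3,4)
proof (induction s rule: dec_induct)
  case base
  have cl: "comparability_closed (cliques E S m) A" and "A \<noteq> {}"
    using conn unfolding comparability_connected_def by auto
  then obtain \<eta> where \<eta>: "\<eta> \<in> A" "\<eta> \<in> cliques E S m"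
    using comparability_closed_subset[OF cl] by blast
  \<comment> \<open>Cut a face down to exactly \<open>m\<close> vertices; comparability keeps it in
    the family, and the required number of edges is still 0.\<close>
  then obtain U where U: "U \<subseteq> \<eta>" "card U = m"
    unfolding cliques_def by (metis (no_types, lifting) mem_Collect_eq obtain_subset_with_card_n)
  then have "U \<in> cliques E S m" using \<eta>(2) by (auto simp: cliques_def)
  then have "U \<in> A" using comparability_closedD[OF cl \<eta>(1)] U(1) by blast
  then show ?case using U by auto
next
  case (step s)
  then obtain U where U: "U \<subseteq> \<Union>A" "card U = s" "\<exists>\<eta>\<in>A. \<eta> \<subseteq> U"
    "m * (s - m) \<le> card (edges_within E U)" by auto
  have cl: "comparability_closed (cliques E S m) A"
    using conn unfolding comparability_connected_def by auto
  have AK: "A \<subseteq> cliques E S m" using cl by (rule comparability_closed_subset)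
  then have "\<Union>A \<subseteq> S" by (auto simp: cliques_def)
  with U(1) have "U \<subseteq> S" by (rule order_trans)
  then have finU: "finite U" using \<open>finite S\<close> by (rule finite_subset)
  \<comment> \<open>\<open>B\<close> is nonempty by the invariant that \<open>U\<close> contains a
    face, and proper because \<open>U\<close> misses a vertex. Connectivity gives a face
    \<open>\<tau>\<close> outside \<open>B\<close> comparable to some \<open>\<sigma>\<close> in
    \<open>B\<close>; as \<open>\<tau>\<close> leaves \<open>U\<close>, it contains
    \<open>\<sigma>\<close>, and a new vertex \<open>w\<close> of \<open>\<tau>\<close> is joined to
    all of \<open>\<sigma>\<close>.\<close>
  define B where "B = {\<eta> \<in> A. \<eta> \<subseteq> U}"
  have "\<not> \<Union>A \<subseteq> U"
  proof
    assume "\<Union>A \<subseteq> U"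
    then have "card (\<Union>A) \<le> s" using card_mono[OF finU] U(2) by blast
    then show False using step.prems by simp
  qed
  then have "B \<noteq> A" "B \<noteq> {}" "B \<subseteq> A" using U(3) unfolding B_def by blast+
  then have "\<not> comparability_closed (cliques E S m) B"
    using comparability_connectedD[OF conn] by metis
  moreover have "B \<subseteq> cliques E S m" using \<open>B \<subseteq> A\<close> AK by (rule order_trans)
  ultimately obtain \<sigma> \<tau> where st: "\<sigma> \<in> B" "\<tau> \<in> cliques E S m" "\<sigma> \<subseteq> \<tau> \<or> \<tau> \<subseteq> \<sigma>" "\<tau> \<notin> B"
    unfolding comparability_closed_def by metis
  then have "\<sigma> \<in> A" "\<sigma> \<subseteq> U" by (simp_all add: B_def)
  then have "\<tau> \<in> A" using comparability_closedD[OF cl _ st(2,3)] by blast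
  then have "\<not> \<tau> \<subseteq> U" using st(4) by (simp add: B_def)
  then obtain w where "w \<in> \<tau>" "w \<notin> U" by blast
  moreover have "\<sigma> \<subseteq> \<tau>" using st(3) \<open>\<sigma> \<subseteq> U\<close> \<open>\<not> \<tau> \<subseteq> U\<close> by blast
  ultimately have st: "\<sigma> \<in> A" "\<sigma> \<subseteq> U" "\<sigma> \<subseteq> \<tau>" "\<tau> \<in> A" "w \<in> \<tau>" "w \<notin> U"
    "\<tau> \<in> cliques E S m" using \<open>\<sigma> \<in> A\<close> \<open>\<sigma> \<subseteq> U\<close> \<open>\<tau> \<in> A\<close> st(2) by blast+
  have "m \<le> card \<sigma>" using subsetD[OF AK st(1)] by (simp add: cliques_def)
  moreover have "{w, x} \<in> E" if "x \<in> \<sigma>" for x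
  proof -
    have "x \<in> \<tau>" "w \<noteq> x" using that st by blast+
    then show ?thesis using st(5,7) by (simp add: cliques_def)
  qed
  ultimately have \<sigma>: "m \<le> card \<sigma>" "\<And>x. x \<in> \<sigma> \<Longrightarrow> {w, x} \<in> E" by blast+
  \<comment> \<open>At least \<open>m\<close> edges at \<open>w\<close>, none of them counted before
    since \<open>w\<close> is outside \<open>U\<close>.\<close>
  let ?N = "(\<lambda>x. {w, x}) ` \<sigma>"
  have "m \<le> card ?N"
    using \<sigma>(1) st(2,6) by (subst card_image) (auto simp: inj_on_def doubleton_eq_iff)
  moreover have "card ?N + card (edges_within E U) = card (?N \<union> edges_within E U)"
    using finU st(2,6) finite_subset
    by (subst card_Un_disjoint) (auto simp: edges_within_def finite_edges_within)
  moreover have "card (?N \<union> edges_within E U) \<le> card (edges_within E (insert w U))"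
  proof (rule card_mono)
    show "finite (edges_within E (insert w U))" using finU by (simp add: finite_edges_within)
    have "card {w, x} = 2" if "x \<in> \<sigma>" for x
    proof -
      have "w \<noteq> x" using that st(2,6) by blast
      then show ?thesis by simp
    qed
    then show "?N \<union> edges_within E U \<subseteq> edges_within E (insert w U)"
      using \<sigma>(2) st(2) by (auto simp: edges_within_def)
  qed
  moreover have "m * (Suc s - m) = m + m * (s - m)"
    using step.hyps by (simp add: Suc_diff_le)
  ultimately have "m * (Suc s - m) \<le> card (edges_within E (insert w U))"
    using U(4) by linarith
  moreover have "card (insert w U) = Suc s" using U(2) finU st by simp
  moreover have "insert w U \<subseteq> \<Union>A" using U(1) st by blast
  moreover have "\<exists>\<eta>\<in>A. \<eta> \<subseteq> insert w U" using U(3) by blast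
  ultimately show ?case by blast
qed

text \<open>This isolates the deterministic half: both sparsity hypotheses concern only vertex sets
  of at most \<open>M\<close> elements. A connected family with all degrees at least
  \<open>2 * k + 2\<close> violates \<open>sparse\<close> or, when it has more than \<open>M\<close>
  vertices, \<open>large\<close>.\<close>

lemma collapsible_if_locally_sparse:
  assumes "finite V" "k + 1 \<le> M"
    and sparse: "\<And>U. \<lbrakk>U \<subseteq> V; 0 < card U; card U \<le> M\<rbrakk>
      \<Longrightarrow> card (edges_within E U) < (k + 1) * card U"
    and large: "\<And>U. \<lbrakk>U \<subseteq> V; card U = M\<rbrakk>
      \<Longrightarrow> card (edges_within E U) < (k + 1) * (M - (k + 1))"
  shows "collapsible (k + 1) (clique_complex V E)"
proof (rule collapsible_clique_complex_if_low_degree[OF assms(1)], rule ccontr)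
  fix S A
  assume S: "S \<subseteq> V" and conn: "comparability_connected (cliques E S (Suc k)) A"
    and "\<not> (\<exists>v\<in>\<Union>A. card (family_nbrs A v) \<le> 2 * k + 1)"
  then have high: "2 * (k + 1) \<le> card (family_nbrs A v)" if "v \<in> \<Union>A" for v
    using that by force
  have finS: "finite S" using S assms(1) finite_subset by blast
  have AK: "A \<subseteq> cliques E S (Suc k)" and "A \<noteq> {}"
    using conn unfolding comparability_connected_def comparability_closed_def by auto
  have US: "\<Union>A \<subseteq> S" using AK unfolding cliques_def by blast
  have finU: "finite (\<Union>A)" using US finS finite_subset by blast
  obtain \<eta> where "\<eta> \<in> A" "\<eta> \<noteq> {}" using AK \<open>A \<noteq> {}\<close> unfolding cliques_def by fastforce
  then have pos: "0 < card (\<Union>A)" using finU by (auto simp: card_gt_0_iff)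
  have "2 * (k + 1) \<le> card {x \<in> \<Union>A - {v}. {v, x} \<in> E}" if "v \<in> \<Union>A" for v
  proof -
    have "card (family_nbrs A v) \<le> card {x \<in> \<Union>A - {v}. {v, x} \<in> E}"
    proof (rule card_mono)
      show "finite {x \<in> \<Union>A - {v}. {v, x} \<in> E}"
        by (rule finite_subset[OF _ finU]) blast
    qed (rule family_nbrs_subset[OF AK])
    then show ?thesis using high[OF that] by simp
  qed
  then have dense: "(k + 1) * card (\<Union>A) \<le> card (edges_within E (\<Union>A))"
    by (rule card_edges_within_min_degree[OF finU])
  show False
  proof (cases "card (\<Union>A) \<le> M")
    case True
    then show ?thesis using sparse[of "\<Union>A"] pos dense US S by force
  next
    case False
    then obtain U where "U \<subseteq> \<Union>A" "card U = M" "Suc k * (M - Suc k) \<le> card (edges_within E U)"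
      using dense_subset_of_connected[OF finS conn, of M] assms(2) by auto
    then show ?thesis using large[of U] US S by force
  qed
qed

section \<open>Union bound\<close>

lemma finite_potential_edges: "finite (potential_edges n)"
  by (rule finite_subset[of _ "Pow {..<n}"]) (auto simp: potential_edges_def)

lemma set_random_graph: "G \<in> set_pmf (random_graph n p) \<Longrightarrow> G \<subseteq> potential_edges n"
  by (auto simp: random_graph_def)

lemma prob_random_graph_superset:
  assumes "0 \<le> p" "p \<le> 1" "R \<subseteq> potential_edges n"
  shows "measure_pmf.prob (random_graph n p) {G. R \<subseteq> G} = p ^ card R"
proof -
  \<comment> \<open>The event is a product over the potential edges, prescribing \<open>True\<close>
    on \<open>R\<close> and nothing elsewhere, so independence makes its probability a
    product.\<close>
  let ?B = "\<lambda>e. if e \<in> R then {True} else UNIV"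
  have "(\<lambda>b. {e \<in> potential_edges n. b e}) -` {G. R \<subseteq> G} = Pi (potential_edges n) ?B"
    using assms(3) by (auto simp: Pi_def split: if_splits)
  then have "measure_pmf.prob (random_graph n p) {G. R \<subseteq> G}
      = (\<Prod>e\<in>potential_edges n. measure_pmf.prob (bernoulli_pmf p) (?B e))"
    unfolding random_graph_def
    by (simp add: measure_Pi_pmf_Pi[OF finite_potential_edges])
  also have "\<dots> = (\<Prod>e\<in>potential_edges n. if e \<in> R then p else 1)"
    using assms(1,2) by (intro prod.cong) (auto simp: measure_pmf_single)
  also have "\<dots> = p ^ card R"
    using assms(3) by (simp add: prod.If_cases[OF finite_potential_edges] Int_absorb1)
  finally show ?thesis .
qed

text \<open>Union bound over all sets \<open>R\<close> of exactly \<open>r\<close> potential edges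
  inside some \<open>s\<close>-set. The crude count \<open>2 ^ (2 ^ s)\<close> of candidates inside
  a given \<open>U\<close> suffices, because it does not depend on \<open>n\<close>.\<close>

lemma prob_random_graph_dense:
  assumes "0 \<le> p" "p \<le> 1"
  shows "measure_pmf.prob (random_graph n p)
      {G. \<exists>U\<subseteq>{..<n}. card U = s \<and> r \<le> card (edges_within G U)}
    \<le> real n ^ s * 2 ^ (2 ^ s) * p ^ r"
proof -
  define \<U> where "\<U> = {U. U \<subseteq> {..<n} \<and> card U = s}"
  define \<R> where "\<R> = {R. R \<subseteq> potential_edges n \<and> card R = r \<and> (\<exists>U\<in>\<U>. R \<subseteq> Pow U)}"
  have fin: "finite \<R>"
    by (rule finite_subset[of _ "Pow (potential_edges n)"])
       (auto simp: \<R>_def finite_potential_edges)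
  have finU: "finite \<U>" by (rule finite_subset[of _ "Pow {..<n}"]) (auto simp: \<U>_def)
  have "card \<R> \<le> card (\<Union>U\<in>\<U>. Pow (Pow U))"
  proof (rule card_mono)
    show "finite (\<Union>U\<in>\<U>. Pow (Pow U))"
      using finU by (auto simp: \<U>_def intro: finite_subset)
  qed (auto simp: \<R>_def)
  also have "\<dots> \<le> (\<Sum>U\<in>\<U>. card (Pow (Pow U)))" by (rule card_UN_le[OF finU])
  also have "\<dots> = (\<Sum>U\<in>\<U>. 2 ^ (2 ^ s))"
  proof (rule sum.cong)
    fix U assume "U \<in> \<U>"
    then have "finite U" "card U = s" by (auto simp: \<U>_def intro: finite_subset)
    then show "card (Pow (Pow U)) = 2 ^ (2 ^ s)" by (simp add: card_Pow)
  qed simp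
  also have "\<dots> = (n choose s) * 2 ^ (2 ^ s)" by (simp add: \<U>_def n_subsets)
  also have "\<dots> \<le> n ^ s * 2 ^ (2 ^ s)"
    by (cases "s \<le> n") (auto simp: binomial_le_pow binomial_eq_0)
  finally have "real (card \<R>) \<le> real (n ^ s * 2 ^ (2 ^ s))" by (rule of_nat_mono)
  then have card: "real (card \<R>) \<le> real n ^ s * 2 ^ (2 ^ s)" by simp
  have "measure_pmf.prob (random_graph n p)
      {G. \<exists>U\<subseteq>{..<n}. card U = s \<and> r \<le> card (edges_within G U)}
    \<le> measure_pmf.prob (random_graph n p) (\<Union>R\<in>\<R>. {G. R \<subseteq> G})"
  proof (rule measure_pmf.finite_measure_mono_AE)
    show "AE G in random_graph n p.
        G \<in> {G. \<exists>U\<subseteq>{..<n}. card U = s \<and> r \<le> card (edges_within G U)}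
          \<longrightarrow> G \<in> (\<Union>R\<in>\<R>. {G. R \<subseteq> G})"
    proof (intro AE_pmfI impI)
      fix G assume G: "G \<in> set_pmf (random_graph n p)"
        and "G \<in> {G. \<exists>U\<subseteq>{..<n}. card U = s \<and> r \<le> card (edges_within G U)}"
      then obtain U where U: "U \<in> \<U>" "r \<le> card (edges_within G U)"
        by (auto simp: \<U>_def)
      obtain R where R: "R \<subseteq> edges_within G U" "card R = r"
        using U(2) by (meson obtain_subset_with_card_n)
      then have "R \<subseteq> G" "R \<subseteq> Pow U" by (auto simp: edges_within_def)
      moreover from this have "R \<subseteq> potential_edges n" using set_random_graph[OF G] by blast
      ultimately show "G \<in> (\<Union>R\<in>\<R>. {G. R \<subseteq> G})" using R(2) U(1) by (auto simp: \<R>_def)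
    qed
  qed simp
  also have "\<dots> \<le> (\<Sum>R\<in>\<R>. measure_pmf.prob (random_graph n p) {G. R \<subseteq> G})"
    by (rule measure_pmf.finite_measure_subadditive_finite[OF fin]) simp
  also have "\<dots> = (\<Sum>R\<in>\<R>. p ^ r)"
    using assms by (intro sum.cong) (auto simp: \<R>_def prob_random_graph_superset)
  also have "\<dots> \<le> real n ^ s * 2 ^ (2 ^ s) * p ^ r"
    using card assms(1) by (simp add: mult_right_mono)
  finally show ?thesis .
qed

section \<open>Asymptotics of the union bound and conclusion\<close>

lemma dense_bound_tendsto_0:
  fixes p :: "nat \<Rightarrow> real" and \<alpha> :: real
  assumes "\<And>n. 0 \<le> p n" "\<And>n. n \<ge> 1 \<Longrightarrow> p n \<le> real n powr (- \<alpha>)"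
    and "real s < real r * \<alpha>"
  shows "(\<lambda>n. real n ^ s * 2 ^ (2 ^ s) * p n ^ r) \<longlonglongrightarrow> 0"
\<comment> \<open>The upper comparison is a constant times a power of \<open>n\<close> whose
  exponent is negative by the last assumption.\<close>
proof (rule tendsto_sandwich[where f = "\<lambda>_. 0"
      and h = "\<lambda>n. 2 ^ (2 ^ s) * real n powr (real s - real r * \<alpha>)"])
  have "(\<lambda>n. real n powr (real s - real r * \<alpha>)) \<longlonglongrightarrow> 0"
    using assms(3) by (intro tendsto_neg_powr filterlim_real_sequentially) simp
  then show "(\<lambda>n. 2 ^ (2 ^ s) * real n powr (real s - real r * \<alpha>)) \<longlonglongrightarrow> 0"
    by (rule tendsto_mult_right_zero)
  show "\<forall>\<^sub>F n in sequentially. real n ^ s * 2 ^ (2 ^ s) * p n ^ r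
      \<le> 2 ^ (2 ^ s) * real n powr (real s - real r * \<alpha>)"
    using eventually_ge_at_top[of 1]
  proof eventually_elim
    case (elim n)
    have "p n ^ r \<le> (real n powr (- \<alpha>)) ^ r" using assms(1,2) elim by (intro power_mono) auto
    also have "\<dots> = real n powr (- (real r * \<alpha>))"
      using elim by (simp add: powr_realpow[symmetric] powr_powr mult.commute)
    finally have "real n ^ s * p n ^ r \<le> real n powr real s * real n powr (- (real r * \<alpha>))"
      using elim by (intro mult_mono) (auto simp: powr_realpow assms(1))
    also have "\<dots> = real n powr (real s - real r * \<alpha>)" by (simp add: powr_add[symmetric])
    finally show ?case by (simp add: mult_ac)
  qed
  show "\<forall>\<^sub>F n in sequentially. 0 \<le> real n ^ s * 2 ^ (2 ^ s) * p n ^ r"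
    using assms(1) by (intro always_eventually allI mult_nonneg_nonneg zero_le_power) auto
qed simp

theorem theorem1p1:
  fixes k :: nat and \<epsilon> :: real and p :: "nat \<Rightarrow> real"
  assumes "\<epsilon> > 0"
    and "\<And>n. 0 \<le> p n \<and> p n \<le> 1"
    and "\<And>n. n \<ge> 1 \<Longrightarrow> p n \<le> real n powr (- 1 / real (k + 1) - \<epsilon>)"
  shows "(\<lambda>n. measure_pmf.prob (random_clique_complex n (p n)) {\<Delta>. collapsible (k + 1) \<Delta>})
           \<longlonglongrightarrow> 1"
proof -
  define \<alpha> where "\<alpha> = 1 / real (k + 1) + \<epsilon>"
  have p: "p n \<le> real n powr (- \<alpha>)" if "n \<ge> 1" for n
    using assms(3)[OF that] by (simp add: \<alpha>_def)
  \<comment> \<open>Since \<open>(k + 1) * \<alpha> = 1 + (k + 1) * \<epsilon>\<close>, having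
    \<open>k + 1\<close> edges per vertex costs slightly more than the factor \<open>n\<close>
    gained by choosing that vertex.\<close>
  have k\<alpha>: "real ((k + 1) * r) * \<alpha> = real r + real ((k + 1) * r) * \<epsilon>" for r
    by (simp add: \<alpha>_def field_simps)
  \<comment> \<open>In a family grown to \<open>M\<close> vertices the first \<open>k + 1\<close>
    contribute no guaranteed edges; the other \<open>L\<close> must have a surplus
    \<open>(k + 1) * L * \<epsilon>\<close> above \<open>k + 1\<close> to pay for them.\<close>
  obtain L :: nat where L: "1 / \<epsilon> < real L" using reals_Archimedean2 by blast
  define M where "M = k + 1 + L"
  define D where "D n s r = {G. \<exists>U\<subseteq>{..<n}. card U = s \<and> r \<le> card (edges_within G U)}"
    for n s r :: nat
  define b where "b n s r = real n ^ s * 2 ^ (2 ^ s) * p n ^ r" for n s r :: nat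
  \<comment> \<open>The sum handles the small families of high minimum degree, the last term those
    grown to \<open>M\<close> vertices.\<close>
  define \<beta> where "\<beta> n = (\<Sum>s=1..M. b n s ((k + 1) * s)) + b n M ((k + 1) * L)" for n
  have b: "measure_pmf.prob (random_graph n (p n)) (D n s r) \<le> b n s r" for n s r
    unfolding D_def b_def using assms(2) by (intro prob_random_graph_dense) auto
  have "(\<lambda>n. b n s ((k + 1) * s)) \<longlonglongrightarrow> 0" if "s \<in> {1..M}" for s
  proof -
    \<comment> \<open>The range starts at \<open>s = 1\<close> because the margin vanishes for the
      empty vertex set.\<close>
    have "0 < real ((k + 1) * s) * \<epsilon>" using assms(1) that by (intro mult_pos_pos of_nat_0_less_iff[THEN iffD2]) auto
    then have "real s < real ((k + 1) * s) * \<alpha>" unfolding k\<alpha> by linarith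
    then show ?thesis
      unfolding b_def using assms(2) p by (intro dense_bound_tendsto_0[where \<alpha> = \<alpha>]) auto
  qed
  moreover have "(\<lambda>n. b n M ((k + 1) * L)) \<longlonglongrightarrow> 0"
  proof -
    have "real (k + 1) * 1 < real (k + 1) * (real L * \<epsilon>)"
      using L assms(1) by (intro mult_strict_left_mono) (simp_all add: field_simps)
    then have "real M < real ((k + 1) * L) * \<alpha>"
      unfolding k\<alpha> M_def by (simp add: algebra_simps)
    then show ?thesis
      unfolding b_def using assms(2) p by (intro dense_bound_tendsto_0[where \<alpha> = \<alpha>]) auto
  qed
  ultimately have "\<beta> \<longlonglongrightarrow> 0 + 0"
    unfolding \<beta>_def by (intro tendsto_add tendsto_null_sum) auto
  then have lim: "(\<lambda>n. 1 - \<beta> n) \<longlonglongrightarrow> 1" by (auto intro!: tendsto_eq_intros)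
  have lower: "1 - \<beta> n \<le> measure_pmf.prob (random_clique_complex n (p n)) {\<Delta>. collapsible (k + 1) \<Delta>}"
    for n
  proof -
    let ?P = "measure_pmf.prob (random_graph n (p n))"
    let ?C = "{G. collapsible (k + 1) (clique_complex {..<n} G)}"
    let ?D = "(\<Union>s\<in>{1..M}. D n s ((k + 1) * s)) \<union> D n M ((k + 1) * L)"
    \<comment> \<open>A graph avoiding every bad event meets the sparsity hypotheses, so the good
      and bad events cover the whole space.\<close>
    have "G \<in> ?C \<union> ?D" for G
    proof (rule ccontr)
      assume G: "G \<notin> ?C \<union> ?D"
      have "collapsible (k + 1) (clique_complex {..<n} G)"
      proof (rule collapsible_if_locally_sparse[where M = M])
        show "card (edges_within G U) < (k + 1) * card U"
          if "U \<subseteq> {..<n}" "0 < card U" "card U \<le> M" for U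
        proof -
          have "G \<notin> D n (card U) ((k + 1) * card U)" using G that(2,3) by auto
          then show ?thesis using that(1) unfolding D_def by (auto simp: not_le)
        qed
        show "card (edges_within G U) < (k + 1) * (M - (k + 1))"
          if "U \<subseteq> {..<n}" "card U = M" for U
        proof -
          have "G \<notin> D n M ((k + 1) * L)" using G by blast
          then show ?thesis using that unfolding D_def by (auto simp: not_le M_def)
        qed
      qed (simp_all add: M_def)
      then show False using G by blast
    qed
    then have "?C \<union> ?D = UNIV" by blast
    then have "1 = ?P (?C \<union> ?D)" by simp
    also have "\<dots> \<le> ?P ?C + ?P ?D" by (rule measure_Un_le) auto
    finally have "1 \<le> ?P ?C + ?P ?D" .
    moreover have "?P ?D \<le> ?P (\<Union>s\<in>{1..M}. D n s ((k + 1) * s)) + ?P (D n M ((k + 1) * L))"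
      by (rule measure_Un_le) auto
    moreover have "?P (\<Union>s\<in>{1..M}. D n s ((k + 1) * s)) \<le> (\<Sum>s=1..M. ?P (D n s ((k + 1) * s)))"
      by (rule measure_pmf.finite_measure_subadditive_finite) auto
    moreover have "\<dots> \<le> (\<Sum>s=1..M. b n s ((k + 1) * s))" by (intro sum_mono b)
    ultimately have "1 - \<beta> n \<le> ?P ?C"
      using b[of n M "(k + 1) * L"] unfolding \<beta>_def by linarith
    then show ?thesis by (simp add: random_clique_complex_def vimage_def)
  qed
  show ?thesis
    by (rule tendsto_sandwich[OF always_eventually[OF allI[OF lower]] _ lim tendsto_const]) simp
qed

end
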